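(* Let $\theta,p$ be positive integers and let $\{P_n^{(\alpha)}(x)\},\{Q_n^{(\alpha)}(x)\}$ ($n\in\mathbb{N}$, $\alpha\in\mathbb{Z}$) be the adjacent families of monic matrix-valued $\theta$-deformed bi-orthogonal polynomials with normalization factors $H_n^{(\alpha)}\in \mathrm{GL}_p(\mathbb{R})$ (see context). Define $q_{n+1}^{(\alpha)}$ ($n\ge0$) and $e_n^{(\alpha)}$ ($n\ge1$) by $$\left(q_{n+1}^{(\alpha)}\right)^{\top}=\left(H_n^{(\alpha)}\right)^{-1}H_n^{(\alpha+\theta)},\qquad \left(e_n^{(\alpha)}\right)^{\top}=\left(H_{n-1}^{(\alpha+1)}\right)^{-1}H_n^{(\alpha)},$$ and $e_0^{(\alpha)}=0$. Let $\mathscr{R}^{(\alpha)}$ be the semi-infinite block upper bidiagonal matrix with diagonal blocks $q_1^{(\alpha)},q_2^{(\alpha)},\dots$ and superdiagonal blocks $\mathbb{I}_p$, and $\mathscr{L}^{(\alpha)}$ the semi-infinite block lower bidiagonal matrix with diagonal blocks $\mathbb{I}_p$ and subdiagonal blocks $e_1^{(\alpha)},e_2^{(\alpha)},\dots$. Then for all $\alpha\in\mathbb{Z}$ $$\mathscr{R}^{(\alpha)}\mathscr{L}^{(\alpha)}=\mathscr{L}^{(\alpha+\theta)}\mathscr{R}^{(\alpha+1)},$$ or equivalently, for all $n\ge1$ and $\alpha\in\mathbb{Z}$, the discrete non-commutative hungry Toda-II lattice holds: $$q_{n+1}^{(\alpha)}e_n^{(\alpha)}=e_n^{(\alpha+\theta)}q_n^{(\alpha+1)},\qquad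 q_n^{(\alpha+1)}+e_{n-1}^{(\alpha+\theta)}=q_n^{(\alpha)}+e_n^{(\alpha)}.$$
   Context: Let $W:\mathbb{R}\to\mathbb{R}^{p\times p}$ be a matrix-valued weight function. For $\alpha\in\mathbb{Z}$ and $f,g\in\mathbb{R}^{p\times p}[x]$ define $$\langle f(x),g(x)\rangle_\theta^{\alpha}=\int_{\mathbb{R}}f(x)\,x^{\alpha}W(x)\,g^{\top}(x^{\theta})\,dx,$$ where $g^\top(x^\theta)$ is the transpose of $g$ evaluated at $x^\theta$. Standing (moment) assumption: all moments $m_k=\int_{\mathbb{R}}x^kW(x)\,dx$, $k\in\mathbb{Z}$, exist and are finite, and for every $\alpha\in\mathbb{Z}$ and $n\in\mathbb{N}$ the block moment matrix $(m_{\alpha+i+j\theta})_{i,j=0}^{n}$ is invertible. Then for each $\alpha$ there are unique sequences of monic matrix-valued polynomials $P_n^{(\alpha)},Q_n^{(\alpha)}\in\mathbb{R}^{p\times p}[x]$ (leading coefficient the identity $\mathbb{I}_p$) of degree $n$ with $$\langle P_n^{(\alpha)}(x),Q_m^{(\alpha)}(x)\rangle_\theta^{\alpha}=H_n^{(\alpha)}\delta_{n,m},\qquad n,m\in\mathbb{N},$$ with $H_n^{(\alpha)}\in\mathrm{GL}_p(\mathbb{R})$. *)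

theory Defs
  imports
    "HOL-Analysis.Analysis"
    "HOL-Computational_Algebra.Polynomial"
    "HOL-Library.Groups_Big_Fun"
begin

(* The library's "poly" would multiply coefficients with the product of the vector type, which is
   componentwise; here the variable is a real scalar. *)
definition mpeval :: "(real^'p^'p) poly \<Rightarrow> real \<Rightarrow> real^'p^'p" where
  "mpeval F x = (\<Sum>i\<le>degree F. x ^ i *\<^sub>R coeff F i)"

definition monic_of_degree :: "nat \<Rightarrow> (real^'p^'p) poly \<Rightarrow> bool" where
  "monic_of_degree n F \<longleftrightarrow> degree F = n \<and> lead_coeff F = mat 1"

(* For negative exponents "0 powi k = 0"; this affects only the null set {0}. *)
definition pairing ::
    "(real \<Rightarrow> real^'p^'p) \<Rightarrow> nat \<Rightarrow> int \<Rightarrow> (real^'p^'p) poly \<Rightarrow> (real^'p^'p) poly \<Rightarrow> real^'p^'p" where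
  "pairing W \<theta> \<alpha> f g =
     (LINT x|lebesgue. mpeval f x ** (x powi \<alpha> *\<^sub>R W x) ** transpose (mpeval g (x ^ \<theta>)))"

definition moment :: "(real \<Rightarrow> real^'p^'p) \<Rightarrow> int \<Rightarrow> real^'p^'p" where
  "moment W k = (LINT x|lebesgue. x powi k *\<^sub>R W x)"

(* Invertibility of the (n+1)p x (n+1)p matrix with p x p blocks M i j, 0 \<le> i, j \<le> n:
   a two-sided inverse N, written blockwise. *)
definition block_invertible :: "nat \<Rightarrow> (nat \<Rightarrow> nat \<Rightarrow> real^'p^'p) \<Rightarrow> bool" where
  "block_invertible n M \<longleftrightarrow>
     (\<exists>N. \<forall>i\<le>n. \<forall>j\<le>n.
        (\<Sum>k\<le>n. M i k ** N k j) = (if i = j then mat 1 else 0) \<and>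
        (\<Sum>k\<le>n. N i k ** M k j) = (if i = j then mat 1 else 0))"

definition moment_assumption :: "(real \<Rightarrow> real^'p^'p) \<Rightarrow> nat \<Rightarrow> bool" where
  "moment_assumption W \<theta> \<longleftrightarrow>
     (\<forall>k::int. integrable lebesgue (\<lambda>x. x powi k *\<^sub>R W x)) \<and>
     (\<forall>(\<alpha>::int) n. block_invertible n (\<lambda>i j. moment W (\<alpha> + int i + int j * int \<theta>)))"

definition biorthogonal ::
    "(real \<Rightarrow> real^'p^'p) \<Rightarrow> nat \<Rightarrow> int \<Rightarrow> (nat \<Rightarrow> (real^'p^'p) poly) \<Rightarrow> (nat \<Rightarrow> (real^'p^'p) poly) \<Rightarrow>
     (nat \<Rightarrow> real^'p^'p) \<Rightarrow> bool" where
  "biorthogonal W \<theta> \<alpha> P Q H \<longleftrightarrow>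
     (\<forall>n. monic_of_degree n (P n) \<and> monic_of_degree n (Q n) \<and> invertible (H n)) \<and>
     (\<forall>n m. pairing W \<theta> \<alpha> (P n) (Q m) = (if n = m then H n else 0))"

(* Semi-infinite block matrices are indexed by nat from 0. Sum_any is the sum over the (for
   bidiagonal factors finite) set of indices with nonzero summand. *)
type_synonym 'p block_matrix = "nat \<Rightarrow> nat \<Rightarrow> real^'p^'p"

definition block_mult :: "'p::finite block_matrix \<Rightarrow> 'p block_matrix \<Rightarrow> 'p block_matrix" where
  "block_mult A B = (\<lambda>i j. Sum_any (\<lambda>k. A i k ** B k j))"

definition upper_bidiag :: "(nat \<Rightarrow> real^'p^'p) \<Rightarrow> 'p::finite block_matrix" where
  "upper_bidiag q = (\<lambda>i j. if j = i then q (i + 1) else if j = i + 1 then mat 1 else 0)"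

definition lower_bidiag :: "(nat \<Rightarrow> real^'p^'p) \<Rightarrow> 'p::finite block_matrix" where
  "lower_bidiag e = (\<lambda>i j. if i = j then mat 1 else if i = j + 1 then e i else 0)"

end

theory Submission
  imports Defs
begin

text \<open>
  Shifting \<open>\<alpha>\<close> by \<open>\<theta>\<close> (resp. by 1) amounts to multiplying the second (resp. first) argument
  of the pairing by \<open>x\<close>. Hence \<open>x Q\<^sub>n\<close> at \<open>\<alpha> + \<theta>\<close> is \<open>Q\<^sub>n\<^sub>+\<^sub>1 + q\<^sub>n\<^sub>+\<^sub>1 Q\<^sub>n\<close> at \<open>\<alpha>\<close>, and \<open>Q\<^sub>n\<close> at
  \<open>\<alpha>\<close> is \<open>Q\<^sub>n + e\<^sub>n Q\<^sub>n\<^sub>-\<^sub>1\<close> at \<open>\<alpha> + 1\<close>. Expanding \<open>x Q\<^sub>n\<close> at \<open>\<alpha> + \<theta>\<close> in the family at \<open>\<alpha> + 1\<close> in the two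
  possible orders and comparing coefficients gives the lattice equations.
\<close>

section \<open>Linearity of the matrix product and of transposition\<close>

lemma bounded_bilinear_matrix_mult:
  "bounded_bilinear ((**) :: real^'n^'m \<Rightarrow> real^'k^'n \<Rightarrow> real^'k^'m)"
proof -
  have "bilinear ((**) :: real^'n^'m \<Rightarrow> real^'k^'n \<Rightarrow> real^'k^'m)"
    unfolding bilinear_def
    by (auto intro!: linearI simp: vec_eq_iff matrix_matrix_mult_def sum.distrib sum_distrib_left
        algebra_simps)
  then show ?thesis
    by (simp add: bilinear_conv_bounded_bilinear)
qed

interpretation matmul: bounded_bilinear "(**) :: real^'n^'m \<Rightarrow> real^'k^'n \<Rightarrow> real^'k^'m"
  by (rule bounded_bilinear_matrix_mult)

lemma linear_transpose: "linear (transpose :: real^'n^'m \<Rightarrow> real^'m^'n)"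
  by (auto intro!: linearI simp: vec_eq_iff transpose_def)

section \<open>Products of bidiagonal block matrices\<close>

lemma block_mult_upper_lower:
  "block_mult (upper_bidiag q) (lower_bidiag e) i j =
    q (i + 1) ** lower_bidiag e i j + lower_bidiag e (i + 1) j"
proof -
  have "block_mult (upper_bidiag q) (lower_bidiag e) i j =
      (\<Sum>k\<in>{i, i + 1}. upper_bidiag q i k ** lower_bidiag e k j)"
    unfolding block_mult_def by (rule Sum_any.expand_superset) (auto simp: upper_bidiag_def)
  then show ?thesis
    by (simp add: upper_bidiag_def)
qed

lemma block_mult_lower_upper:
  "block_mult (lower_bidiag e) (upper_bidiag q) i j =
    upper_bidiag q i j + (if i = 0 then 0 else e i ** upper_bidiag q (i - 1) j)"
proof -
  have "block_mult (lower_bidiag e) (upper_bidiag q) i j =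
      (\<Sum>k\<in>{i, i - 1}. lower_bidiag e i k ** upper_bidiag q k j)"
    unfolding block_mult_def by (rule Sum_any.expand_superset) (auto simp: lower_bidiag_def)
  then show ?thesis
    by (cases i) (simp_all add: lower_bidiag_def)
qed

text \<open>Both products are tridiagonal with superdiagonal blocks \<open>mat 1\<close>. The
  diagonal yields the sum equations and the subdiagonal the product equations; row 0 stands apart,
  since it receives no \<open>e'\<close> term.\<close>

lemma block_mult_bidiag_eqI:
  assumes "q 1 + e 1 = q' 1"
    and "\<And>n. n \<ge> 1 \<Longrightarrow> q (n + 1) ** e n = e' n ** q' n"
    and "\<And>n. n \<ge> 1 \<Longrightarrow> q (n + 1) + e (n + 1) = q' (n + 1) + e' n"
  shows "block_mult (upper_bidiag q) (lower_bidiag e) =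
    block_mult (lower_bidiag e') (upper_bidiag q')"
proof (intro ext)
  fix i j
  show "block_mult (upper_bidiag q) (lower_bidiag e) i j =
    block_mult (lower_bidiag e') (upper_bidiag q') i j"
    unfolding block_mult_upper_lower block_mult_lower_upper
    using assms(1) assms(2)[of i] assms(3)[of i]
    by (cases i) (auto simp: upper_bidiag_def lower_bidiag_def)
qed

section \<open>Block moment matrices and the pairing in terms of moments\<close>

lemma block_invertible_kernel_trivial:
  assumes "block_invertible n M"
    and "\<And>k. k \<le> n \<Longrightarrow> (\<Sum>j\<le>n. M k j ** X j) = 0"
    and "i \<le> n"
  shows "X i = 0"
proof -
  obtain N where N: "\<And>i j. i \<le> n \<Longrightarrow> j \<le> n \<Longrightarrow>
      (\<Sum>k\<le>n. N i k ** M k j) = (if i = j then mat 1 else 0)"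
    using assms(1) unfolding block_invertible_def by blast
  have "X i = (\<Sum>j\<le>n. (if i = j then mat 1 else 0) ** X j)"
    using assms(3) by (simp add: if_distrib[of "\<lambda>A. A ** _"] sum.delta cong: if_cong)
  also have "\<dots> = (\<Sum>j\<le>n. \<Sum>k\<le>n. N i k ** (M k j ** X j))"
    using assms(3) by (intro sum.cong) (auto simp: N[symmetric] matmul.sum_left matrix_mul_assoc)
  also have "\<dots> = (\<Sum>k\<le>n. N i k ** (\<Sum>j\<le>n. M k j ** X j))"
    by (subst sum.swap) (simp add: matmul.sum_right)
  also have "\<dots> = 0"
    using assms(2) by simp
  finally show ?thesis .
qed

lemma pairing_eq_sum_moments:
  fixes W :: "real \<Rightarrow> real^'p^'p"
  assumes int: "\<And>k. integrable lebesgue (\<lambda>x. x powi k *\<^sub>R W x)"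
  shows "pairing W \<theta> \<alpha> f g = (\<Sum>i\<le>degree f. \<Sum>j\<le>degree g.
    coeff f i ** moment W (\<alpha> + int i + int j * int \<theta>) ** transpose (coeff g j))"
proof -
  let ?T = "\<lambda>i j x. coeff f i ** (x powi (\<alpha> + int i + int j * int \<theta>) *\<^sub>R W x) ** transpose (coeff g j)"
  have bl: "bounded_linear (\<lambda>A. coeff f i ** A ** transpose (coeff g j))" for i j
    by (intro bounded_linear_compose[OF matmul.bounded_linear_left matmul.bounded_linear_right])
  have T_int: "integrable lebesgue (?T i j)" for i j
    by (rule integrable_bounded_linear[OF bl int])
  have T_eq: "(LINT x|lebesgue. ?T i j x) =
      coeff f i ** moment W (\<alpha> + int i + int j * int \<theta>) ** transpose (coeff g j)" for i j
    unfolding moment_def by (rule integral_bounded_linear[OF bl int])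
  \<comment> \<open>The exponent law for \<open>powi\<close> can fail at 0 (as for
    \<open>0 powi (-1 + 1)\<close>), so the expansion is pointwise only off this null set.\<close>
  have pointwise: "mpeval f x ** (x powi \<alpha> *\<^sub>R W x) ** transpose (mpeval g (x ^ \<theta>)) =
      (\<Sum>i\<le>degree f. \<Sum>j\<le>degree g. ?T i j x)" if "x \<noteq> 0" for x
  proof -
    have tr: "transpose (mpeval g (x ^ \<theta>)) =
        (\<Sum>j\<le>degree g. (x ^ \<theta>) ^ j *\<^sub>R transpose (coeff g j))"
      unfolding mpeval_def by (simp add: linear_sum[OF linear_transpose] linear_cmul[OF linear_transpose])
    have pow: "x powi (\<alpha> + int i + int j * int \<theta>) = x ^ i * x powi \<alpha> * (x ^ \<theta>) ^ j" for i j
    proof -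
      have "x powi (int j * int \<theta>) = (x ^ \<theta>) ^ j"
        by (metis mult.commute of_nat_mult power_int_of_nat power_mult)
      then show ?thesis
        using that by (simp add: power_int_add)
    qed
    show ?thesis
      unfolding tr mpeval_def[of f]
      by (simp add: matmul.sum_left matmul.sum_right matmul.scaleR_left matmul.scaleR_right pow
          mult_ac scaleR_sum_right) (rule sum.swap)
  qed
  have "pairing W \<theta> \<alpha> f g = (LINT x|lebesgue. (\<Sum>i\<le>degree f. \<Sum>j\<le>degree g. ?T i j x))"
    unfolding pairing_def
  proof (rule integral_cong_AE)
    have ae: "AE x in lebesgue. x \<noteq> (0::real)"
      by (intro AE_I'[where N="{0}"]) auto
    show "AE x in lebesgue. mpeval f x ** (x powi \<alpha> *\<^sub>R W x) ** transpose (mpeval g (x ^ \<theta>)) =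
        (\<Sum>i\<le>degree f. \<Sum>j\<le>degree g. ?T i j x)"
      using ae by eventually_elim (rule pointwise)
    show "(\<lambda>x. \<Sum>i\<le>degree f. \<Sum>j\<le>degree g. ?T i j x) \<in> borel_measurable lebesgue"
      by (intro borel_measurable_sum borel_measurable_integrable T_int)
    show "(\<lambda>x. mpeval f x ** (x powi \<alpha> *\<^sub>R W x) ** transpose (mpeval g (x ^ \<theta>)))
        \<in> borel_measurable lebesgue"
    proof -
      \<comment> \<open>The integrand is the measurable double sum with its value at 0 replaced by a
        constant.\<close>
      have "(\<lambda>x. if x \<in> {0} then mpeval f 0 ** (0 powi \<alpha> *\<^sub>R W 0) ** transpose (mpeval g (0 ^ \<theta>))
          else \<Sum>i\<le>degree f. \<Sum>j\<le>degree g. ?T i j x) \<in> borel_measurable lebesgue"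
        by (intro measurable_If_set measurable_const borel_measurable_sum
            borel_measurable_integrable T_int) auto
      then show ?thesis
        by (rule measurable_cong[THEN iffD1, rotated]) (simp add: pointwise)
    qed
  qed
  also have "\<dots> = (\<Sum>i\<le>degree f. \<Sum>j\<le>degree g. LINT x|lebesgue. ?T i j x)"
    by (simp add: Bochner_Integration.integral_sum Bochner_Integration.integrable_sum T_int)
  finally show ?thesis
    by (simp add: T_eq)
qed

text \<open>The pairing of the monomial \<open>x\<^sup>k\<close> times the identity with \<open>f\<close>.\<close>

definition moment_functional ::
    "(real \<Rightarrow> real^'p^'p) \<Rightarrow> nat \<Rightarrow> int \<Rightarrow> (real^'p^'p) poly \<Rightarrow> nat \<Rightarrow> real^'p^'p" where
  "moment_functional W \<theta> \<alpha> f k =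
     (\<Sum>j\<le>degree f. moment W (\<alpha> + int k + int j * int \<theta>) ** transpose (coeff f j))"

lemma moment_functional_eq_sum:
  assumes "degree f \<le> N"
  shows "moment_functional W \<theta> \<alpha> f k =
    (\<Sum>j\<le>N. moment W (\<alpha> + int k + int j * int \<theta>) ** transpose (coeff f j))"
  unfolding moment_functional_def
  by (rule sum.mono_neutral_left) (use assms in \<open>auto simp: coeff_eq_0 linear_0[OF linear_transpose]\<close>)

lemma moment_functional_shift:
  "moment_functional W \<theta> (\<alpha> + 1) f k = moment_functional W \<theta> \<alpha> f (Suc k)"
  by (simp add: moment_functional_def add_ac)

text \<open>The second argument of the pairing is evaluated at \<open>x ^ \<theta>\<close>, so a
  factor \<open>x\<close> there raises the exponent of the weight by
  \<open>\<theta>\<close>.\<close>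

lemma moment_functional_pCons_0:
  "moment_functional W \<theta> \<alpha> (pCons 0 f) k = moment_functional W \<theta> (\<alpha> + int \<theta>) f k"
  unfolding moment_functional_eq_sum[OF degree_pCons_le] sum.atMost_Suc_shift
  by (simp add: moment_functional_def linear_0[OF linear_transpose] algebra_simps)

text \<open>The passage from monomials to the monic \<open>P k\<close> is unitriangular: once the
  functionals below \<open>k\<close> vanish, only the leading term of \<open>P k\<close> survives in
  its pairing with \<open>Q n\<close>.\<close>

lemma biorthogonal_moment_functional:
  assumes bi: "biorthogonal W \<theta> \<alpha> P Q H"
    and int: "\<And>k. integrable lebesgue (\<lambda>x. x powi k *\<^sub>R W x)"
    and "k \<le> n"
  shows "moment_functional W \<theta> \<alpha> (Q n) k = (if k = n then H n else 0)"
  using \<open>k \<le> n\<close>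
proof (induction k rule: less_induct)
  case (less k)
  let ?D = "moment_functional W \<theta> \<alpha> (Q n)"
  have deg: "degree (P k) = k" and lead: "coeff (P k) k = mat 1"
    using bi unfolding biorthogonal_def monic_of_degree_def by metis+
  have "(if k = n then H n else 0) = pairing W \<theta> \<alpha> (P k) (Q n)"
    using bi by (auto simp: biorthogonal_def)
  also have "\<dots> = (\<Sum>i\<le>k. coeff (P k) i ** ?D i)"
    by (simp add: pairing_eq_sum_moments[OF int] deg moment_functional_def matmul.sum_right
        matrix_mul_assoc)
  also have "\<dots> = (\<Sum>i<k. coeff (P k) i ** ?D i) + ?D k"
    by (simp add: lessThan_Suc_atMost[symmetric] lead)
  also have "(\<Sum>i<k. coeff (P k) i ** ?D i) = 0"
    using less by (intro sum.neutral) auto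
  finally show ?case by simp
qed

text \<open>As \<open>F\<close> and \<open>G\<close> are both monic, \<open>F - G - a R\<close> has degree at most \<open>n\<close>, so its first \<open>n + 1\<close>
  moments determine it.\<close>

lemma monic_combination_unique:
  fixes F G R :: "(real^'p^'p) poly"
  assumes inv: "block_invertible n (\<lambda>i j. moment W (\<alpha> + int i + int j * int \<theta>))"
    and F: "monic_of_degree (Suc n) F" and G: "monic_of_degree (Suc n) G" and R: "degree R \<le> n"
    and eq: "\<And>k. k \<le> n \<Longrightarrow> moment_functional W \<theta> \<alpha> F k =
      moment_functional W \<theta> \<alpha> G k + moment_functional W \<theta> \<alpha> R k ** transpose a"
  shows "coeff F j = coeff G j + a ** coeff R j"
proof -
  \<comment> \<open>Moments multiply transposed coefficients from the left, so the kernel vector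
    consists of the transposed coefficients of \<open>F - G - a R\<close>. The top ones cancel,
    which leaves a square system of \<open>n + 1\<close> blocks.\<close>
  define X where "X j = transpose (coeff F j) - transpose (coeff G j)
    - transpose (coeff R j) ** transpose a" for j
  have top: "transpose (coeff F (Suc n)) = transpose (coeff G (Suc n))"
    using F G by (auto simp: monic_of_degree_def)
  have X_transpose: "X j = transpose (coeff F j - coeff G j - a ** coeff R j)" for j
    by (simp add: X_def linear_diff[OF linear_transpose] matrix_transpose_mul)
  have low: "X j = 0" if "j \<le> n" for j
  proof (rule block_invertible_kernel_trivial[OF inv _ that])
    fix k assume k: "k \<le> n"
    have FG: "degree F \<le> Suc n" "degree G \<le> Suc n"
      using F G by (auto simp: monic_of_degree_def)
    show "(\<Sum>j\<le>n. moment W (\<alpha> + int k + int j * int \<theta>) ** X j) = 0"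
      using eq[OF k] top
      unfolding moment_functional_eq_sum[OF FG(1)] moment_functional_eq_sum[OF FG(2)]
        moment_functional_eq_sum[OF R]
      by (simp add: X_def matmul.diff_right sum_subtractf matmul.sum_left matrix_mul_assoc)
  qed
  have high: "coeff F j - coeff G j - a ** coeff R j = 0" if "\<not> j \<le> n" for j
    using F G R that by (cases "j = Suc n") (auto simp: monic_of_degree_def coeff_eq_0)
  have "coeff F j - coeff G j - a ** coeff R j = 0"
  proof (cases "j \<le> n")
    case True
    then have "transpose (X j) = 0"
      by (simp add: low linear_0[OF linear_transpose])
    then show ?thesis
      by (simp add: X_transpose)
  qed (rule high)
  then show ?thesis
    by (simp add: algebra_simps)
qed

lemma matrix_mult_matrix_inv_cancel:
  fixes A :: "real^'p^'p"
  assumes "invertible A"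
  shows "A ** (matrix_inv A ** B) = B"
proof -
  have "A ** matrix_inv A = mat 1"
    using assms unfolding invertible_def matrix_inv_def by (rule someI2_ex) simp
  then show ?thesis
    by (simp add: matrix_mul_assoc)
qed

theorem mainTheorem5:
  fixes W :: "real \<Rightarrow> real^'p^'p"
    and \<theta> :: nat
    and P Q :: "int \<Rightarrow> nat \<Rightarrow> (real^'p^'p) poly"
    and H q e :: "int \<Rightarrow> nat \<Rightarrow> real^'p^'p"
  assumes "\<theta> \<ge> 1"
    and "moment_assumption W \<theta>"
    and "\<And>\<alpha>. biorthogonal W \<theta> \<alpha> (P \<alpha>) (Q \<alpha>) (H \<alpha>)"
    and "\<And>\<alpha> n. transpose (q \<alpha> (n + 1)) = matrix_inv (H \<alpha> n) ** H (\<alpha> + int \<theta>) n"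
    and "\<And>\<alpha> n. n \<ge> 1 \<Longrightarrow> transpose (e \<alpha> n) = matrix_inv (H (\<alpha> + 1) (n - 1)) ** H \<alpha> n"
    and "\<And>\<alpha>. e \<alpha> 0 = 0"
  shows "(\<forall>\<alpha>. block_mult (upper_bidiag (q \<alpha>)) (lower_bidiag (e \<alpha>)) =
              block_mult (lower_bidiag (e (\<alpha> + int \<theta>))) (upper_bidiag (q (\<alpha> + 1)))) \<and>
         (\<forall>\<alpha> n. n \<ge> 1 \<longrightarrow>
              q \<alpha> (n + 1) ** e \<alpha> n = e (\<alpha> + int \<theta>) n ** q (\<alpha> + 1) n \<and>
              q (\<alpha> + 1) n + e (\<alpha> + int \<theta>) (n - 1) = q \<alpha> n + e \<alpha> n)"
proof -
  have inv: "block_invertible n (\<lambda>i j. moment W (\<alpha> + int i + int j * int \<theta>))" for \<alpha> n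
    using assms(2) by (simp add: moment_assumption_def)
  have D: "moment_functional W \<theta> \<alpha> (Q \<alpha> n) k = (if k = n then H \<alpha> n else 0)" if "k \<le> n" for \<alpha> n k
    by (rule biorthogonal_moment_functional[OF assms(3) _ that])
      (use assms(2) in \<open>simp add: moment_assumption_def\<close>)
  have Q: "monic_of_degree n (Q \<alpha> n)" and H: "invertible (H \<alpha> n)" for \<alpha> n
    using assms(3)[of \<alpha>] by (auto simp: biorthogonal_def)
  have deg: "degree (Q \<alpha> n) = n" and lead: "coeff (Q \<alpha> n) n = mat 1" for \<alpha> n
    using Q[of n \<alpha>] by (auto simp: monic_of_degree_def)
  \<comment> \<open>This ensures that \<open>pCons 0\<close> raises the degree by one.\<close>
  have Q_nonzero: "Q \<alpha> n \<noteq> 0" for \<alpha> n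
  proof
    assume "Q \<alpha> n = 0"
    then have "(mat 1 :: real^'p^'p) $ i $ i = 0" for i
      using lead[of \<alpha> n] by simp
    then show False
      by (simp add: mat_def)
  qed

  \<comment> \<open>Moments below \<open>n\<close> vanish on both sides; the one at \<open>n\<close>
    reads \<open>H (\<alpha> + int \<theta>) n = H \<alpha> n ** transpose (q \<alpha> (n +
    1))\<close>, the definition of \<open>q\<close>.\<close>
  have q_rel: "coeff (pCons 0 (Q (\<alpha> + int \<theta>) n)) j =
      coeff (Q \<alpha> (Suc n)) j + q \<alpha> (Suc n) ** coeff (Q \<alpha> n) j" for \<alpha> n j
  proof (rule monic_combination_unique[OF inv])
    show "monic_of_degree (Suc n) (pCons 0 (Q (\<alpha> + int \<theta>) n))"
      by (simp add: monic_of_degree_def deg lead Q_nonzero)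
    show "moment_functional W \<theta> \<alpha> (pCons 0 (Q (\<alpha> + int \<theta>) n)) k =
      moment_functional W \<theta> \<alpha> (Q \<alpha> (Suc n)) k +
      moment_functional W \<theta> \<alpha> (Q \<alpha> n) k ** transpose (q \<alpha> (Suc n))" if "k \<le> n" for k
      using that assms(4)[of \<alpha> n]
      by (simp add: moment_functional_pCons_0 D matrix_mult_matrix_inv_cancel[OF H])
  qed (simp_all add: Q deg)

  \<comment> \<open>At \<open>\<alpha> + 1\<close> the \<open>k\<close>-th moment of
    \<open>Q \<alpha> (Suc n)\<close> is its moment \<open>k + 1\<close> at \<open>\<alpha>\<close>,
    nonzero among \<open>k \<le> n\<close> only for \<open>k = n\<close>; there the definition of
    \<open>e\<close> applies.\<close>
  have e_rel: "coeff (Q \<alpha> (Suc n)) j =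
      coeff (Q (\<alpha> + 1) (Suc n)) j + e \<alpha> (Suc n) ** coeff (Q (\<alpha> + 1) n) j" for \<alpha> n j
  proof (rule monic_combination_unique[OF inv])
    show "moment_functional W \<theta> (\<alpha> + 1) (Q \<alpha> (Suc n)) k =
      moment_functional W \<theta> (\<alpha> + 1) (Q (\<alpha> + 1) (Suc n)) k +
      moment_functional W \<theta> (\<alpha> + 1) (Q (\<alpha> + 1) n) k ** transpose (e \<alpha> (Suc n))" if "k \<le> n" for k
      using that assms(5)[of "Suc n" \<alpha>]
      by (simp add: D matrix_mult_matrix_inv_cancel[OF H])
        (simp add: moment_functional_shift D)
  qed (simp_all add: Q deg)

  \<comment> \<open>Lattice equations by comparison of coefficients\<close>
  have shift: "\<alpha> + int \<theta> + 1 = \<alpha> + 1 + int \<theta>" for \<alpha>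
    by simp

  have sum_0: "q \<alpha> 1 + e \<alpha> 1 = q (\<alpha> + 1) 1" for \<alpha>
  proof -
    \<comment> \<open>A multiple of \<open>x\<close> has constant coefficient 0, so both sides are
      0.\<close>
    have "(q \<alpha> 1 + e \<alpha> 1) + coeff (Q (\<alpha> + 1) 1) 0 = q (\<alpha> + 1) 1 + coeff (Q (\<alpha> + 1) 1) 0"
      using q_rel[of \<alpha> 0 0] q_rel[of "\<alpha> + 1" 0 0] e_rel[of \<alpha> 0 0]
      by (simp add: lead add_ac)
    then show ?thesis
      by simp
  qed
  \<comment> \<open>Left: \<open>q_rel\<close>, then \<open>e_rel\<close> at
    \<open>\<alpha>\<close>. Right: \<open>e_rel\<close> at \<open>\<alpha> + int \<theta>\<close>,
    then \<open>q_rel\<close> at \<open>\<alpha> + 1\<close>. The common term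
    \<open>Q (\<alpha> + 1) (n + 2)\<close> has been cancelled.\<close>
  have two_expansions: "q \<alpha> (n + 2) ** coeff (Q (\<alpha> + 1) (n + 1)) j
        + q \<alpha> (n + 2) ** e \<alpha> (n + 1) ** coeff (Q (\<alpha> + 1) n) j
        + e \<alpha> (n + 2) ** coeff (Q (\<alpha> + 1) (n + 1)) j
      = q (\<alpha> + 1) (n + 2) ** coeff (Q (\<alpha> + 1) (n + 1)) j
        + e (\<alpha> + int \<theta>) (n + 1) ** coeff (Q (\<alpha> + 1) (n + 1)) j
        + e (\<alpha> + int \<theta>) (n + 1) ** q (\<alpha> + 1) (n + 1) ** coeff (Q (\<alpha> + 1) n) j" for \<alpha> n j
  proof -
    have "coeff (pCons 0 (Q (\<alpha> + int \<theta>) (Suc n))) j = coeff (pCons 0 (Q (\<alpha> + 1 + int \<theta>) (Suc n))) j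
        + e (\<alpha> + int \<theta>) (Suc n) ** coeff (pCons 0 (Q (\<alpha> + 1 + int \<theta>) n)) j"
      using e_rel[of "\<alpha> + int \<theta>" n "j - 1"] by (cases j) (simp_all add: shift)
    then show ?thesis
      unfolding q_rel e_rel[of \<alpha>]
      by (simp add: matmul.add_right matrix_mul_assoc algebra_simps)
  qed
  \<comment> \<open>At degree \<open>n + 1\<close> the polynomial \<open>Q (\<alpha> + 1) n\<close>
    contributes nothing and \<open>Q (\<alpha> + 1) (n + 1)\<close> contributes
    \<open>mat 1\<close>.\<close>
  have sum_Suc: "q \<alpha> (n + 2) + e \<alpha> (n + 2) = q (\<alpha> + 1) (n + 2) + e (\<alpha> + int \<theta>) (n + 1)" for \<alpha> n
    using two_expansions[of \<alpha> n "n + 1"] lead[of "\<alpha> + 1" "n + 1"]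
    by (simp add: coeff_eq_0 deg)
  have prod: "q \<alpha> (n + 2) ** e \<alpha> (n + 1) = e (\<alpha> + int \<theta>) (n + 1) ** q (\<alpha> + 1) (n + 1)" for \<alpha> n
  proof -
    \<comment> \<open>At degree \<open>n\<close> the unknown coefficient \<open>?c\<close> enters
      both sides with equal left factors by \<open>sum_Suc\<close>, so its terms cancel.\<close>
    let ?c = "coeff (Q (\<alpha> + 1) (n + 1)) n"
    have "(q \<alpha> (n + 2) + e \<alpha> (n + 2)) ** ?c = (q (\<alpha> + 1) (n + 2) + e (\<alpha> + int \<theta>) (n + 1)) ** ?c"
      by (simp only: sum_Suc)
    then show ?thesis
      using two_expansions[of \<alpha> n n] by (simp add: lead matmul.add_left algebra_simps)
  qed
  have lattice: "q \<alpha> (n + 1) ** e \<alpha> n = e (\<alpha> + int \<theta>) n ** q (\<alpha> + 1) n"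
    "q (\<alpha> + 1) n + e (\<alpha> + int \<theta>) (n - 1) = q \<alpha> n + e \<alpha> n" if n: "n \<ge> 1" for \<alpha> n
  proof -
    obtain m where m: "n = Suc m"
      using n by (cases n) auto
    show "q \<alpha> (n + 1) ** e \<alpha> n = e (\<alpha> + int \<theta>) n ** q (\<alpha> + 1) n"
      using prod[of \<alpha> m] by (simp add: m)
    show "q (\<alpha> + 1) n + e (\<alpha> + int \<theta>) (n - 1) = q \<alpha> n + e \<alpha> n"
      \<comment> \<open>For \<open>n = 1\<close> the convention \<open>e _ 0 = 0\<close> turns the
        equation into \<open>sum_0\<close>.\<close>
      using sum_0[of \<alpha>] sum_Suc[of \<alpha> "m - 1"] by (cases m) (simp_all add: m assms(6))
  qed
  have "block_mult (upper_bidiag (q \<alpha>)) (lower_bidiag (e \<alpha>)) =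
      block_mult (lower_bidiag (e (\<alpha> + int \<theta>))) (upper_bidiag (q (\<alpha> + 1)))" for \<alpha>
    by (rule block_mult_bidiag_eqI)
      (use sum_0 lattice(1) lattice(2)[of "Suc _"] in simp_all)
  with lattice show ?thesis
    by blast
qed

end
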